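(* Let $m,n$ be positive integers. The $2$-rigid elements of $\mathcal{I}_2$ having $m$ elements of rank $2$ and $n$ elements of rank $1$ are in one-to-one correspondence, via $\pi\mapsto L_\pi$, with the subdirect products of the chains $[m]$ and $[n]$.
   Context: $\mathcal{I}_2=\mathrm{Av}(321)$ is the set of all (finite) permutations with no decreasing subsequence of length 3. A permutation $\pi\in\mathcal{I}_2$ is identified with its set of points $(i,\pi(i))$; it is $2$-rigid if every element of $\pi$ belongs to a subset whose pattern is $21$ (i.e. to an inversion). An element $x\in\pi$ has rank $2$ if it is the larger element of some $21$-pattern in $\pi$, and rank $1$ otherwise. The elements of each given rank form an increasing sequence, so one may speak of the $i$th element of rank 2 and the $j$th element of rank 1 (in increasing order). $[m]=\{1,2,\dots,m\}$ is a chain regarded as a lattice, and $[m]\times[n]$ is the product lattice. For a $2$-rigid $\pi\in\mathcal{I}_2$ with $m$ elements of rank 2 and $n$ elements of rank 1, $L_\pi\subseteq[m]\times[n]$ is the set of pairs $(i,j)$ such that the $i$th element of rank 2 and the $j$th element of rank 1 form a $21$-pattern in $\pi$. A subdirect product of $[m]$ and $[n]$ is a sublattice of $[m]\times[n]$ whose projections to $[m]$ and to $[n]$ are both surjective. *)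

theory Defs
  imports "HOL-Combinatorics.Permutations" "HOL-Library.Product_Order"
begin

text \<open>
  A permutation of \<open>{1..N}\<close> is represented by its set of points \<open>(i, p i)\<close>.  The type
  \<^typ>\<open>nat \<times> nat\<close> carries the componentwise lattice order of
  \<^theory>\<open>HOL-Library.Product_Order\<close>.
\<close>

definition perm_points :: "nat \<Rightarrow> (nat \<Rightarrow> nat) \<Rightarrow> (nat \<times> nat) set" where
  "perm_points N p = (\<lambda>i. (i, p i)) ` {1..N}"

definition finite_perms :: "(nat \<times> nat) set set" where
  "finite_perms = {\<pi>. \<exists>N p. p permutes {1..N} \<and> \<pi> = perm_points N p}"

text \<open>The points \<open>x\<close>, \<open>y\<close> form a 21-pattern in which \<open>x\<close> is the larger element.\<close>

definition pattern21 :: "nat \<times> nat \<Rightarrow> nat \<times> nat \<Rightarrow> bool" where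
  "pattern21 x y \<longleftrightarrow> fst x < fst y \<and> snd x > snd y"

definition Av321 :: "(nat \<times> nat) set set" where
  "Av321 = {\<pi> \<in> finite_perms.
     \<not> (\<exists>x\<in>\<pi>. \<exists>y\<in>\<pi>. \<exists>z\<in>\<pi>. pattern21 x y \<and> pattern21 y z)}"

definition two_rigid :: "(nat \<times> nat) set \<Rightarrow> bool" where
  "two_rigid \<pi> \<longleftrightarrow> (\<forall>x\<in>\<pi>. \<exists>y\<in>\<pi>. pattern21 x y \<or> pattern21 y x)"

definition rank :: "(nat \<times> nat) set \<Rightarrow> nat \<times> nat \<Rightarrow> nat" where
  "rank \<pi> x = (if \<exists>y\<in>\<pi>. pattern21 x y then 2 else 1)"

definition of_rank :: "(nat \<times> nat) set \<Rightarrow> nat \<Rightarrow> (nat \<times> nat) set" where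
  "of_rank \<pi> r = {x \<in> \<pi>. rank \<pi> x = r}"

text \<open>
  \<open>x\<close> is the \<open>k\<close>th element of rank \<open>r\<close>, counting from 1.  For \<open>\<pi> \<in> Av321\<close> the elements of a
  given rank form a chain in the componentwise order, so the order by position, the order by
  value and the order \<open>\<le>\<close> used here agree.
\<close>

definition is_kth_of_rank :: "(nat \<times> nat) set \<Rightarrow> nat \<Rightarrow> nat \<Rightarrow> nat \<times> nat \<Rightarrow> bool" where
  "is_kth_of_rank \<pi> r k x \<longleftrightarrow> x \<in> of_rank \<pi> r \<and> card {z \<in> of_rank \<pi> r. z \<le> x} = k"

definition L :: "(nat \<times> nat) set \<Rightarrow> (nat \<times> nat) set" where
  "L \<pi> = {(i, j). \<exists>x y. is_kth_of_rank \<pi> 2 i x \<and> is_kth_of_rank \<pi> 1 j y \<and> pattern21 x y}"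

definition sublattice_of :: "'a::lattice set \<Rightarrow> 'a set \<Rightarrow> bool" where
  "sublattice_of S A \<longleftrightarrow> S \<subseteq> A \<and> (\<forall>x\<in>S. \<forall>y\<in>S. inf x y \<in> S \<and> sup x y \<in> S)"

definition subdirect_product :: "nat \<Rightarrow> nat \<Rightarrow> (nat \<times> nat) set \<Rightarrow> bool" where
  "subdirect_product m n S \<longleftrightarrow>
     sublattice_of S ({1..m} \<times> {1..n}) \<and> fst ` S = {1..m} \<and> snd ` S = {1..n}"

end

theory Submission
  imports Defs
begin

text \<open>
  In a 321-avoiding permutation no element is both the larger member of one inversion and the
  smaller member of another.  Hence every inversion pairs an element \<open>a\<close> of rank 2 with an element
  \<open>b\<close> of rank 1, the elements of equal rank form a chain, and in the 2-rigid case every element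
  occurs in some pair of \<open>L \<pi>\<close>.

  \<open>L \<pi>\<close> is a sublattice for the following reason.  That \<open>a\<close> lies to the left of \<open>b\<close> survives
  making \<open>a\<close> smaller or \<open>b\<close> larger in its chain; that \<open>a\<close> lies above \<open>b\<close> survives making \<open>a\<close> larger
  or \<open>b\<close> smaller.  If two inversions are incomparable, each of these two conditions is inherited by
  their meet and by their join from one of the two inversions.

  Conversely \<open>L \<pi>\<close> determines the relative order of each \<open>a\<close> and each \<open>b\<close>.  The rank 1 elements forming an inversion with \<open>a\<close> are an interval of the rank 1 chain; those
  before that interval lie to the left of \<open>a\<close>, the others to the right, and those after it lie above
  \<open>a\<close>, the others below.  As a point of a permutation has position and value equal to the number
  of points weakly to its left and weakly below it, this gives closed formulas for the
  coordinates in terms of \<open>L \<pi>\<close> (lemma \<open>perm_of_L\<close>).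

  The same formulas make sense for any subdirect product \<open>S\<close>.  Closure under meets and joins
  together with surjectivity of the two projections is what makes the points so
  defined a permutation (lemma \<open>perm_of_in_finite_perms\<close>) whose inversions are exactly the pairs
  in \<open>S\<close> (lemma \<open>pattern21_upper_lower\<close>).  So \<open>perm_of\<close> is a two-sided inverse of \<open>L\<close>.

  Inverting a 2-rigid 321-avoiding permutation exchanges the two ranks and replaces \<open>L \<pi>\<close> by its
  converse.  The construction of \<open>perm_of\<close> respects this symmetry, so comparisons of values follow
  from comparisons of positions, and monotonicity in rank 1 from monotonicity in rank 2.
\<close>

section \<open>Indices in finite chains\<close>

definition chain_index :: "'a::order set \<Rightarrow> 'a \<Rightarrow> nat" where
  "chain_index R x = card {z \<in> R. z \<le> x}"

lemma chain_index_le_iff: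
  assumes fin: "finite R" and chain: "\<And>x z. x \<in> R \<Longrightarrow> z \<in> R \<Longrightarrow> x \<le> z \<or> z \<le> x"
    and x: "x \<in> R" and z: "z \<in> R"
  shows "chain_index R z \<le> chain_index R x \<longleftrightarrow> z \<le> x"
proof
  assume "z \<le> x"
  then show "chain_index R z \<le> chain_index R x"
    unfolding chain_index_def using fin by (intro card_mono) auto
next
  assume le: "chain_index R z \<le> chain_index R x"
  show "z \<le> x"
  proof (rule ccontr)
    assume n: "\<not> z \<le> x"
    with chain[OF x z] have "x \<le> z" by blast
    then have "{w \<in> R. w \<le> x} \<subseteq> {w \<in> R. w \<le> z}" using order_trans by blast
    moreover have "z \<in> {w \<in> R. w \<le> z}" "z \<notin> {w \<in> R. w \<le> x}" using n z by simp_all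
    ultimately have "{w \<in> R. w \<le> x} \<subset> {w \<in> R. w \<le> z}" by blast
    with fin have "card {w \<in> R. w \<le> x} < card {w \<in> R. w \<le> z}" by (intro psubset_card_mono) auto
    with le show False by (simp add: chain_index_def)
  qed
qed

lemma bij_betw_chain_index:
  assumes fin: "finite R" and chain: "\<And>x z. x \<in> R \<Longrightarrow> z \<in> R \<Longrightarrow> x \<le> z \<or> z \<le> x"
  shows "bij_betw (chain_index R) R {1..card R}"
proof -
  have inj: "inj_on (chain_index R) R"
    by (rule inj_onI) (metis antisym chain_index_le_iff[OF fin chain] order_refl)
  have "chain_index R x \<in> {1..card R}" if "x \<in> R" for x
  proof -
    from that have "{z \<in> R. z \<le> x} \<noteq> {}" by auto
    with fin have "card {z \<in> R. z \<le> x} > 0" by (simp add: card_gt_0_iff)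
    moreover from fin have "card {z \<in> R. z \<le> x} \<le> card R" by (intro card_mono) auto
    ultimately show ?thesis by (simp add: chain_index_def)
  qed
  then have "chain_index R ` R \<subseteq> {1..card R}" by blast
  moreover from inj have "card (chain_index R ` R) = card {1..card R}" by (simp add: card_image)
  ultimately have "chain_index R ` R = {1..card R}" by (intro card_subset_eq) auto
  with inj show ?thesis by (simp add: bij_betw_def)
qed

lemma chain_index_strict_mono_image:
  fixes f :: "nat \<Rightarrow> 'a::order"
  assumes mono: "\<And>i k. i \<in> {1..m} \<Longrightarrow> k \<in> {1..m} \<Longrightarrow> i < k \<Longrightarrow> f i < f k"
    and i: "i \<in> {1..m}"
  shows "chain_index (f ` {1..m}) (f i) = i"
proof -
  have "k \<le> i" if k: "k \<in> {1..m}" and le: "f k \<le> f i" for k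
  proof (rule ccontr)
    assume "\<not> k \<le> i"
    then have "f i < f k" using mono[OF i k] by simp
    with le show False by simp
  qed
  moreover have "f k \<le> f i" if k: "k \<in> {1..m}" and "k \<le> i" for k
  proof (cases "k = i")
    case False
    with \<open>k \<le> i\<close> have "f k < f i" using mono[OF k i] by simp
    then show ?thesis by (rule less_imp_le)
  qed simp
  ultimately have "{k \<in> {1..m}. f k \<le> f i} = {1..i}"
    using i unfolding set_eq_iff mem_Collect_eq atLeastAtMost_iff by (meson le_trans)
  then have "{z \<in> f ` {1..m}. z \<le> f i} = f ` {1..i}" by blast
  moreover have "inj_on f {1..i}"
  proof (rule linorder_inj_onI)
    fix k l assume "k < l" "k \<in> {1..i}" "l \<in> {1..i}"
    with mono[of k l] i show "f k \<noteq> f l" by auto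
  qed auto
  ultimately show ?thesis by (simp add: chain_index_def card_image)
qed

section \<open>Permutations as point sets\<close>

text \<open>This form treats positions and values alike, as the later counting arguments do.\<close>

lemma in_finite_perms_iff:
  "\<pi> \<in> finite_perms \<longleftrightarrow> (\<exists>N. bij_betw fst \<pi> {1..N} \<and> bij_betw snd \<pi> {1..N})"
proof
  assume "\<pi> \<in> finite_perms"
  then obtain N p where p: "p permutes {1..N}" and \<pi>: "\<pi> = (\<lambda>i. (i, p i)) ` {1..N}"
    by (auto simp: finite_perms_def perm_points_def)
  have "bij_betw fst \<pi> {1..N}"
    by (auto simp: \<pi> bij_betw_def inj_on_def image_image)
  moreover have "bij_betw snd \<pi> {1..N}"
    using permutes_inj[OF p] permutes_image[OF p]
    by (auto simp: \<pi> bij_betw_def inj_on_def image_image)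
  ultimately show "\<exists>N. bij_betw fst \<pi> {1..N} \<and> bij_betw snd \<pi> {1..N}" by blast
next
  assume "\<exists>N. bij_betw fst \<pi> {1..N} \<and> bij_betw snd \<pi> {1..N}"
  then obtain N where f: "bij_betw fst \<pi> {1..N}" and s: "bij_betw snd \<pi> {1..N}" by blast
  define g where "g = inv_into \<pi> fst"
  define p where "p i = (if i \<in> {1..N} then snd (g i) else i)" for i
  have g: "bij_betw g {1..N} \<pi>" unfolding g_def by (rule bij_betw_inv_into[OF f])
  have "bij_betw (snd \<circ> g) {1..N} {1..N}" using bij_betw_trans[OF g s] .
  then have "bij_betw p {1..N} {1..N}" by (rule bij_betw_cong[THEN iffD1, rotated]) (simp add: p_def)
  then have "p permutes {1..N}" by (rule bij_imp_permutes) (auto simp: p_def)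
  moreover have "fst (g i) = i" if "i \<in> {1..N}" for i
    using bij_betw_inv_into_right[OF f that] by (simp add: g_def)
  then have "(\<lambda>i. (i, p i)) ` {1..N} = g ` {1..N}"
    by (intro image_cong) (auto simp: p_def prod_eq_iff)
  then have "\<pi> = perm_points N p"
    using g by (simp add: perm_points_def bij_betw_def)
  ultimately show "\<pi> \<in> finite_perms" by (auto simp: finite_perms_def)
qed

lemma card_le_eq_self:
  fixes f :: "'a \<Rightarrow> nat"
  assumes f: "bij_betw f \<pi> {1..N}" and x: "x \<in> \<pi>"
  shows "card {z \<in> \<pi>. f z \<le> f x} = f x"
proof -
  have im: "f ` \<pi> = {1..N}" using f by (simp add: bij_betw_def)
  have "f x \<le> N" using im x by auto
  have "f ` {z \<in> \<pi>. f z \<le> f x} = f ` \<pi> \<inter> {..f x}" by blast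
  also have "\<dots> = {1..f x}" using im \<open>f x \<le> N\<close> by auto
  finally have "f ` {z \<in> \<pi>. f z \<le> f x} = {1..f x}" .
  moreover have "inj_on f {z \<in> \<pi>. f z \<le> f x}"
    using f by (auto simp: bij_betw_def inj_on_def)
  ultimately show ?thesis using card_image[of f "{z \<in> \<pi>. f z \<le> f x}"] by simp
qed

section \<open>The permutation of a subdirect product\<close>

text \<open>
  With \<open>S = L \<pi>\<close>, the next two sets are the indices of the rank 1 elements below, respectively to
  the left of, the \<open>i\<close>th element of rank 2.  For the converse of \<open>S\<close> they describe the rank 2
  elements to the left of, respectively below, an element of rank 1.
\<close>

definition reached :: "(nat \<times> nat) set \<Rightarrow> nat \<Rightarrow> nat \<Rightarrow> nat set" where
  "reached S n i = {j \<in> {1..n}. \<exists>j'. (i, j') \<in> S \<and> j \<le> j'}"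

definition passed :: "(nat \<times> nat) set \<Rightarrow> nat \<Rightarrow> nat \<Rightarrow> nat set" where
  "passed S n i = {j \<in> {1..n}. \<forall>j'. (i, j') \<in> S \<longrightarrow> j < j'}"

text \<open>
  The number of points weakly to the left of the \<open>i\<close>th element of rank 2, and of those weakly below
  it: \<open>i\<close> of them have rank 2, the others rank 1.
\<close>

definition upper_point :: "(nat \<times> nat) set \<Rightarrow> nat \<Rightarrow> nat \<Rightarrow> nat \<times> nat" where
  "upper_point S n i = (i + card (passed S n i), i + card (reached S n i))"

definition lower_point :: "(nat \<times> nat) set \<Rightarrow> nat \<Rightarrow> nat \<Rightarrow> nat \<times> nat" where
  "lower_point S m j = prod.swap (upper_point (S\<inverse>) m j)"

definition perm_of :: "nat \<Rightarrow> nat \<Rightarrow> (nat \<times> nat) set \<Rightarrow> (nat \<times> nat) set" where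
  "perm_of m n S = upper_point S n ` {1..m} \<union> lower_point S m ` {1..n}"

lemma finite_reached [simp]: "finite (reached S n i)"
  and finite_passed [simp]: "finite (passed S n i)"
  by (simp_all add: reached_def passed_def)

lemma card_reached_le: "card (reached S n i) \<le> n"
  using card_mono[of "{1..n}" "reached S n i"] by (simp add: reached_def subset_iff)

lemma card_passed_le: "card (passed S n i) \<le> n"
  using card_mono[of "{1..n}" "passed S n i"] by (simp add: passed_def subset_iff)

lemma subdirect_product_iff:
  "subdirect_product m n S \<longleftrightarrow>
     (\<forall>i j. (i, j) \<in> S \<longrightarrow> i \<in> {1..m} \<and> j \<in> {1..n}) \<and>
     (\<forall>i j i' j'. (i, j) \<in> S \<longrightarrow> (i', j') \<in> S \<longrightarrow>
        (min i i', min j j') \<in> S \<and> (max i i', max j j') \<in> S) \<and>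
     (\<forall>i\<in>{1..m}. \<exists>j. (i, j) \<in> S) \<and> (\<forall>j\<in>{1..n}. \<exists>i. (i, j) \<in> S)"
  (is "_ \<longleftrightarrow> ?B \<and> ?C \<and> ?R \<and> ?K")
proof -
  have B: "S \<subseteq> {1..m} \<times> {1..n} \<longleftrightarrow> ?B" by (simp only: subset_iff split_paired_All mem_Sigma_iff)
  have "fst ` S = Domain S" "snd ` S = Range S" by force+
  then have RK: "fst ` S = {1..m} \<and> snd ` S = {1..n} \<longleftrightarrow> ?R \<and> ?K" if ?B
    using that by (simp only:) blast
  have C: "(\<forall>x\<in>S. \<forall>y\<in>S. inf x y \<in> S \<and> sup x y \<in> S) \<longleftrightarrow> ?C"
    unfolding Ball_def split_paired_All inf_prod_def sup_prod_def inf_min sup_max fst_conv snd_conv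
    by blast
  show ?thesis
    unfolding subdirect_product_def sublattice_of_def B C conj_assoc
    by (intro conj_cong refl RK)
qed

lemma subdirect_product_converse:
  "subdirect_product m n S \<Longrightarrow> subdirect_product n m (S\<inverse>)"
  unfolding subdirect_product_iff converse_iff by blast

context
  fixes m n :: nat and S :: "(nat \<times> nat) set"
  assumes S: "subdirect_product m n S"
begin

lemma subdirect_meet: "(i, j) \<in> S \<Longrightarrow> (i', j') \<in> S \<Longrightarrow> (min i i', min j j') \<in> S"
  using S unfolding subdirect_product_iff by blast

lemma subdirect_join: "(i, j) \<in> S \<Longrightarrow> (i', j') \<in> S \<Longrightarrow> (max i i', max j j') \<in> S"
  using S unfolding subdirect_product_iff by blast

lemma subdirect_bounds: "(i, j) \<in> S \<Longrightarrow> i \<in> {1..m} \<and> j \<in> {1..n}"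
  using S unfolding subdirect_product_iff by blast

lemma subdirect_row: assumes "i \<in> {1..m}" obtains j where "(i, j) \<in> S"
  using assms S unfolding subdirect_product_iff by blast

lemma subdirect_column: assumes "j \<in> {1..n}" obtains i where "(i, j) \<in> S"
  using assms S unfolding subdirect_product_iff by blast

text \<open>
  As the row index grows, so does \<open>reached\<close> (join an entry of the lower row with one of the higher
  row) and so does \<open>passed\<close> (take their meet instead).
\<close>

lemma upper_point_mono:
  assumes i: "i \<in> {1..m}" and k: "k \<in> {1..m}" and "i < k"
  shows "fst (upper_point S n i) < fst (upper_point S n k) \<and>
         snd (upper_point S n i) < snd (upper_point S n k)"
proof -
  obtain a b where a: "(i, a) \<in> S" and b: "(k, b) \<in> S" using subdirect_row i k by metis
  have "passed S n i \<subseteq> passed S n k"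
  proof
    fix j assume j: "j \<in> passed S n i"
    have "j < j'" if "(k, j') \<in> S" for j'
      using subdirect_meet[OF a that] \<open>i < k\<close> j by (auto simp: passed_def min_def split: if_splits)
    with j show "j \<in> passed S n k" by (simp add: passed_def)
  qed
  moreover have "reached S n i \<subseteq> reached S n k"
  proof
    fix j assume j: "j \<in> reached S n i"
    then obtain j' where j': "(i, j') \<in> S" "j \<le> j'" by (auto simp: reached_def)
    have "(k, max j' b) \<in> S" using subdirect_join[OF j'(1) b] \<open>i < k\<close> by (simp add: max_def)
    with j j' show "j \<in> reached S n k" by (auto simp: reached_def le_max_iff_disj)
  qed
  ultimately show ?thesis
    using \<open>i < k\<close> by (auto simp: upper_point_def intro!: add_less_le_mono card_mono)
qed

text \<open>
  If \<open>i\<close> is reached from column \<open>j\<close> then, by a meet, \<open>j\<close> is not passed by row \<open>i\<close>; otherwise, by a join,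
  it is.  Both sets being initial segments, their cardinalities are bounded by comparing them
  with initial segments that end at, or just before, \<open>i\<close> and \<open>j\<close>.
\<close>

lemma fst_upper_lower:
  assumes i: "i \<in> {1..m}" and j: "j \<in> {1..n}"
  shows "if i \<in> reached (S\<inverse>) m j
         then fst (upper_point S n i) < fst (lower_point S m j)
         else fst (lower_point S m j) < fst (upper_point S n i)"
proof (cases "i \<in> reached (S\<inverse>) m j")
  case True
  then obtain i' where i': "(i', j) \<in> S" "i \<le> i'" by (auto simp: reached_def)
  obtain l where l: "(i, l) \<in> S" using subdirect_row i by metis
  have "(i, min j l) \<in> S" using subdirect_meet[OF i'(1) l] i'(2) by (simp add: min_def split: if_splits)
  then have "passed S n i \<subseteq> {1..<j}" by (auto simp: passed_def min_def split: if_splits)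
  then have "card (passed S n i) \<le> card {1..<j}" by (rule card_mono[rotated]) simp
  moreover have "{1..i} \<subseteq> reached (S\<inverse>) m j" using i i' by (auto simp: reached_def)
  then have "card {1..i} \<le> card (reached (S\<inverse>) m j)" by (rule card_mono[OF finite_reached])
  ultimately show ?thesis using True i j by (auto simp: upper_point_def lower_point_def)
next
  case False
  obtain k where k: "(k, j) \<in> S" using subdirect_column j by metis
  have "j < j'" if "(i, j') \<in> S" for j'
  proof (rule ccontr)
    assume "\<not> j < j'"
    then have "(max k i, j) \<in> S" using subdirect_join[OF k that] by (simp add: max_def)
    with False i show False by (auto simp: reached_def)
  qed
  then have "{1..j} \<subseteq> passed S n i" using j by (fastforce simp: passed_def)
  then have "card {1..j} \<le> card (passed S n i)" by (rule card_mono[OF finite_passed])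
  moreover have "reached (S\<inverse>) m j \<subseteq> {1..<i}"
    using False i by (force simp: reached_def not_le)
  then have "card (reached (S\<inverse>) m j) \<le> card {1..<i}" by (rule card_mono[rotated]) simp
  ultimately show ?thesis using False i by (auto simp: upper_point_def lower_point_def)
qed

end

context
  fixes m n :: nat and S :: "(nat \<times> nat) set"
  assumes S: "subdirect_product m n S"
begin

lemma lower_point_mono:
  assumes "j \<in> {1..n}" and "k \<in> {1..n}" and "j < k"
  shows "fst (lower_point S m j) < fst (lower_point S m k) \<and>
         snd (lower_point S m j) < snd (lower_point S m k)"
  using upper_point_mono[OF subdirect_product_converse[OF S] assms] by (simp add: lower_point_def)

lemma snd_upper_lower:
  assumes i: "i \<in> {1..m}" and j: "j \<in> {1..n}"
  shows "if j \<in> reached S n i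
         then snd (lower_point S m j) < snd (upper_point S n i)
         else snd (upper_point S n i) < snd (lower_point S m j)"
  using fst_upper_lower[OF subdirect_product_converse[OF S] j i]
  unfolding lower_point_def converse_converse fst_swap snd_swap .

lemma pattern21_upper_lower:
  assumes i: "i \<in> {1..m}" and j: "j \<in> {1..n}"
  shows "pattern21 (upper_point S n i) (lower_point S m j) \<longleftrightarrow> (i, j) \<in> S"
proof -
  have "i \<in> reached (S\<inverse>) m j \<and> j \<in> reached S n i \<longleftrightarrow> (i, j) \<in> S"
  proof
    assume "i \<in> reached (S\<inverse>) m j \<and> j \<in> reached S n i"
    then obtain i' j' where "(i', j) \<in> S" "i \<le> i'" "(i, j') \<in> S" "j \<le> j'"
      by (auto simp: reached_def)
    then show "(i, j) \<in> S" using subdirect_meet[OF S, of i' j i j'] by (simp add: min_absorb1 min_absorb2)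
  qed (use i j in \<open>auto simp: reached_def\<close>)
  then show ?thesis
    using fst_upper_lower[OF S i j] snd_upper_lower[OF i j]
    by (auto simp: pattern21_def split: if_splits)
qed

text \<open>
  Column \<open>j\<close> has an entry \<open>(i', j)\<close> with \<open>i \<le> i'\<close>, or row \<open>i\<close> has an entry \<open>(i, j')\<close> with \<open>j \<le> j'\<close>.
  Otherwise the join of any entry of row \<open>i\<close> with any entry of column \<open>j\<close> would be \<open>(i, j)\<close>, which
  is itself such an entry.
\<close>

lemma not_pattern21_lower_upper:
  assumes i: "i \<in> {1..m}" and j: "j \<in> {1..n}"
  shows "\<not> pattern21 (lower_point S m j) (upper_point S n i)"
proof -
  obtain k where k: "(k, j) \<in> S" using subdirect_column[OF S j] .
  obtain l where l: "(i, l) \<in> S" using subdirect_row[OF S i] .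
  have "i \<in> reached (S\<inverse>) m j \<or> j \<in> reached S n i"
  proof (rule ccontr)
    assume "\<not> ?thesis"
    with k l i j have "k < i" "l < j" by (auto simp: reached_def not_le)
    with subdirect_join[OF S k l] \<open>\<not> ?thesis\<close> i j show False by (auto simp: reached_def max_def)
  qed
  then show ?thesis
    using fst_upper_lower[OF S i j] snd_upper_lower[OF i j]
    by (auto simp: pattern21_def split: if_splits)
qed

lemma not_pattern21_upper_upper:
  assumes "i \<in> {1..m}" "k \<in> {1..m}"
  shows "\<not> pattern21 (upper_point S n i) (upper_point S n k)"
  using upper_point_mono[OF S assms] upper_point_mono[OF S assms(2,1)]
  by (cases i k rule: linorder_cases) (auto simp: pattern21_def)

lemma not_pattern21_lower_lower:
  assumes "i \<in> {1..n}" "k \<in> {1..n}"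
  shows "\<not> pattern21 (lower_point S m i) (lower_point S m k)"
  using lower_point_mono[OF assms] lower_point_mono[OF assms(2,1)]
  by (cases i k rule: linorder_cases) (auto simp: pattern21_def)

text \<open>
  In each coordinate the points take \<open>m + n\<close> pairwise distinct values between 1 and \<open>m + n\<close>, hence
  all of these values.
\<close>

lemma perm_of_in_finite_perms: "perm_of m n S \<in> finite_perms"
proof -
  let ?U = "upper_point S n" and ?W = "lower_point S m"
  have bij: "bij_betw f (perm_of m n S) {1..m + n}"
    if U: "\<And>i k. i \<in> {1..m} \<Longrightarrow> k \<in> {1..m} \<Longrightarrow> i < k \<Longrightarrow> f (?U i) < f (?U k)"
    and W: "\<And>i k. i \<in> {1..n} \<Longrightarrow> k \<in> {1..n} \<Longrightarrow> i < k \<Longrightarrow> f (?W i) < f (?W k)"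
    and UW: "\<And>i j. i \<in> {1..m} \<Longrightarrow> j \<in> {1..n} \<Longrightarrow> f (?U i) \<noteq> f (?W j)"
    and bound: "f ` perm_of m n S \<subseteq> {1..m + n}" for f :: "nat \<times> nat \<Rightarrow> nat"
  proof -
    have iU: "inj_on (f \<circ> ?U) {1..m}"
      by (rule inj_onI) (metis U comp_apply less_irrefl linorder_neqE_nat)
    have iW: "inj_on (f \<circ> ?W) {1..n}"
      by (rule inj_onI) (metis W comp_apply less_irrefl linorder_neqE_nat)
    have eq: "f ` perm_of m n S = (f \<circ> ?U) ` {1..m} \<union> (f \<circ> ?W) ` {1..n}"
      by (simp add: perm_of_def image_Un image_comp)
    have inj: "inj_on f (perm_of m n S)"
      unfolding perm_of_def inj_on_Un
      using inj_on_imageI[OF iU] inj_on_imageI[OF iW] UW by fastforce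
    have "card (f ` perm_of m n S) = card ((f \<circ> ?U) ` {1..m}) + card ((f \<circ> ?W) ` {1..n})"
      unfolding eq using UW by (intro card_Un_disjoint) auto
    also have "\<dots> = m + n" unfolding card_image[OF iU] card_image[OF iW] by simp
    finally have "card (f ` perm_of m n S) = card {1..m + n}" by simp
    then have "f ` perm_of m n S = {1..m + n}" using bound by (intro card_subset_eq) simp_all
    with inj show ?thesis by (simp add: bij_betw_def)
  qed
  have "bij_betw fst (perm_of m n S) {1..m + n}"
  proof (rule bij)
    show "fst (?U i) \<noteq> fst (?W j)" if "i \<in> {1..m}" "j \<in> {1..n}" for i j
      using fst_upper_lower[OF S that] by (auto split: if_splits)
    show "fst ` perm_of m n S \<subseteq> {1..m + n}"
      using card_passed_le[of S n] card_reached_le[of "S\<inverse>" m]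
      by (auto simp: perm_of_def upper_point_def lower_point_def add_le_mono add.commute[of m n])
         (simp add: add.commute add_le_mono)
  qed (use upper_point_mono[OF S] lower_point_mono in blast)+
  moreover have "bij_betw snd (perm_of m n S) {1..m + n}"
  proof (rule bij)
    show "snd (?U i) \<noteq> snd (?W j)" if "i \<in> {1..m}" "j \<in> {1..n}" for i j
      using snd_upper_lower[OF that] by (auto split: if_splits)
    show "snd ` perm_of m n S \<subseteq> {1..m + n}"
      using card_reached_le[of S n] card_passed_le[of "S\<inverse>" m]
      by (auto simp: perm_of_def upper_point_def lower_point_def add_le_mono add.commute[of m n])
         (simp add: add.commute add_le_mono)
  qed (use upper_point_mono[OF S] lower_point_mono in blast)+
  ultimately show ?thesis by (auto simp: in_finite_perms_iff)
qed

lemma pattern21_perm_of: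
  assumes "x \<in> perm_of m n S" "y \<in> perm_of m n S" "pattern21 x y"
  shows "\<exists>i j. (i, j) \<in> S \<and> x = upper_point S n i \<and> y = lower_point S m j"
  using assms pattern21_upper_lower not_pattern21_lower_upper
    not_pattern21_upper_upper not_pattern21_lower_lower
  unfolding perm_of_def by blast

lemma rank_upper_point:
  assumes i: "i \<in> {1..m}"
  shows "rank (perm_of m n S) (upper_point S n i) = 2"
proof -
  obtain j where "(i, j) \<in> S" using subdirect_row[OF S i] .
  then have "pattern21 (upper_point S n i) (lower_point S m j)" "j \<in> {1..n}"
    using pattern21_upper_lower subdirect_bounds[OF S] by blast+
  then show ?thesis by (auto simp: rank_def perm_of_def)
qed

lemma rank_lower_point:
  assumes j: "j \<in> {1..n}"
  shows "rank (perm_of m n S) (lower_point S m j) = 1"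
  using not_pattern21_lower_upper[OF _ j] not_pattern21_lower_lower[OF j]
  by (auto simp: rank_def perm_of_def)

lemma of_rank_2_perm_of: "of_rank (perm_of m n S) 2 = upper_point S n ` {1..m}"
  using rank_upper_point rank_lower_point by (fastforce simp: of_rank_def perm_of_def)

lemma of_rank_1_perm_of: "of_rank (perm_of m n S) 1 = lower_point S m ` {1..n}"
  using rank_upper_point rank_lower_point by (fastforce simp: of_rank_def perm_of_def)

lemma upper_point_less:
  "i \<in> {1..m} \<Longrightarrow> k \<in> {1..m} \<Longrightarrow> i < k \<Longrightarrow> upper_point S n i < upper_point S n k"
  using upper_point_mono[OF S] by (fastforce simp: less_le_not_le less_eq_prod_def)

lemma lower_point_less:
  "i \<in> {1..n} \<Longrightarrow> k \<in> {1..n} \<Longrightarrow> i < k \<Longrightarrow> lower_point S m i < lower_point S m k"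
  using lower_point_mono by (fastforce simp: less_le_not_le less_eq_prod_def)

lemma card_of_rank_perm_of:
  "card (of_rank (perm_of m n S) 2) = m" "card (of_rank (perm_of m n S) 1) = n"
proof -
  have "inj_on (upper_point S n) {1..m}" "inj_on (lower_point S m) {1..n}"
    by (intro inj_onI; metis upper_point_less lower_point_less less_irrefl linorder_neqE_nat)+
  then show "card (of_rank (perm_of m n S) 2) = m" "card (of_rank (perm_of m n S) 1) = n"
    unfolding of_rank_1_perm_of of_rank_2_perm_of by (simp_all add: card_image)
qed

lemma perm_of_in_Av321: "perm_of m n S \<in> Av321"
proof -
  have False if xy: "pattern21 x y" and yz: "pattern21 y z"
    and xyz: "x \<in> perm_of m n S" "y \<in> perm_of m n S" "z \<in> perm_of m n S" for x y z
  proof -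
    obtain i j where j: "(i, j) \<in> S" "y = lower_point S m j"
      using pattern21_perm_of[OF xyz(1,2) xy] by blast
    obtain k l where k: "(k, l) \<in> S" "y = upper_point S n k"
      using pattern21_perm_of[OF xyz(2,3) yz] by blast
    have "rank (perm_of m n S) y = 1"
      using rank_lower_point[of j] subdirect_bounds[OF S j(1)] j(2) by simp
    moreover have "rank (perm_of m n S) y = 2"
      using rank_upper_point[of k] subdirect_bounds[OF S k(1)] k(2) by simp
    ultimately show False by simp
  qed
  with perm_of_in_finite_perms show ?thesis unfolding Av321_def by blast
qed

lemma two_rigid_perm_of: "two_rigid (perm_of m n S)"
  unfolding two_rigid_def
proof
  fix x assume "x \<in> perm_of m n S"
  then consider i where "i \<in> {1..m}" "x = upper_point S n i" | j where "j \<in> {1..n}" "x = lower_point S m j"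
    by (auto simp: perm_of_def)
  then obtain i j where "(i, j) \<in> S" "x = upper_point S n i \<or> x = lower_point S m j"
    by cases (metis subdirect_row[OF S] subdirect_column[OF S])+
  with pattern21_upper_lower subdirect_bounds[OF S]
  show "\<exists>y\<in>perm_of m n S. pattern21 x y \<or> pattern21 y x"
    unfolding perm_of_def by blast
qed

lemma is_kth_perm_of:
  "is_kth_of_rank (perm_of m n S) 2 i x \<longleftrightarrow> i \<in> {1..m} \<and> x = upper_point S n i"
  "is_kth_of_rank (perm_of m n S) 1 j x \<longleftrightarrow> j \<in> {1..n} \<and> x = lower_point S m j"
proof -
  have index: "x \<in> f ` {1..k} \<and> chain_index (f ` {1..k}) x = i \<longleftrightarrow> i \<in> {1..k} \<and> x = f i"
    if "\<And>i. i \<in> {1..k} \<Longrightarrow> chain_index (f ` {1..k}) (f i) = i" for f :: "nat \<Rightarrow> nat \<times> nat" and i k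
  proof
    assume x: "x \<in> f ` {1..k} \<and> chain_index (f ` {1..k}) x = i"
    then obtain l where l: "l \<in> {1..k}" "x = f l" by blast
    with that x have "l = i" by metis
    with l show "i \<in> {1..k} \<and> x = f i" by blast
  qed (use that in blast)
  show "is_kth_of_rank (perm_of m n S) 2 i x \<longleftrightarrow> i \<in> {1..m} \<and> x = upper_point S n i"
    unfolding is_kth_of_rank_def chain_index_def[symmetric] of_rank_2_perm_of
    by (rule index[OF chain_index_strict_mono_image[OF upper_point_less]])
  show "is_kth_of_rank (perm_of m n S) 1 j x \<longleftrightarrow> j \<in> {1..n} \<and> x = lower_point S m j"
    unfolding is_kth_of_rank_def chain_index_def[symmetric] of_rank_1_perm_of
    by (rule index[OF chain_index_strict_mono_image[OF lower_point_less]])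
qed

lemma L_perm_of: "L (perm_of m n S) = S"
  using pattern21_upper_lower subdirect_bounds[OF S]
  unfolding L_def is_kth_perm_of by blast

end

section \<open>Recovering a permutation from its inversions\<close>

context
  fixes \<pi> :: "(nat \<times> nat) set"
  assumes Av: "\<pi> \<in> Av321" and rigid: "two_rigid \<pi>"
begin

abbreviation (input) "index r \<equiv> chain_index (of_rank \<pi> r)"

lemma rank_cases: "\<pi> = of_rank \<pi> 2 \<union> of_rank \<pi> 1" "of_rank \<pi> 2 \<inter> of_rank \<pi> 1 = {}"
  by (auto simp: of_rank_def rank_def)

lemma coordinates_bij: obtains N where "bij_betw fst \<pi> {1..N}" "bij_betw snd \<pi> {1..N}"
  using Av by (auto simp: Av321_def in_finite_perms_iff)

lemma finite_of_rank: "finite (of_rank \<pi> r)"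
proof -
  obtain N where "bij_betw fst \<pi> {1..N}" by (rule coordinates_bij)
  then have "finite \<pi>" using bij_betw_finite by blast
  then show ?thesis by (simp add: of_rank_def)
qed

lemma coordinates_inj:
  assumes "x \<in> \<pi>" "y \<in> \<pi>"
  shows "fst x = fst y \<longleftrightarrow> x = y" "snd x = snd y \<longleftrightarrow> x = y"
proof -
  obtain N where "bij_betw fst \<pi> {1..N}" "bij_betw snd \<pi> {1..N}" by (rule coordinates_bij)
  then have "inj_on fst \<pi>" "inj_on snd \<pi>" by (simp_all add: bij_betw_def)
  from inj_on_eq_iff[OF this(1) assms] inj_on_eq_iff[OF this(2) assms]
  show "fst x = fst y \<longleftrightarrow> x = y" "snd x = snd y \<longleftrightarrow> x = y" .
qed

lemma pattern21_ranks:
  assumes "x \<in> \<pi>" "y \<in> \<pi>" "pattern21 x y"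
  shows "x \<in> of_rank \<pi> 2" "y \<in> of_rank \<pi> 1"
proof -
  have "\<not> pattern21 y z" if "z \<in> \<pi>" for z
    using Av assms that unfolding Av321_def by blast
  then have "rank \<pi> y = 1" by (simp add: rank_def)
  moreover have "rank \<pi> x = 2" using assms unfolding rank_def by (simp only: if_P bexI[of _ y])
  ultimately show "x \<in> of_rank \<pi> 2" "y \<in> of_rank \<pi> 1"
    using assms by (simp_all add: of_rank_def)
qed

lemma of_rank_coordinates:
  assumes x: "x \<in> of_rank \<pi> r" and y: "y \<in> of_rank \<pi> r"
  shows "fst x \<le> fst y \<longleftrightarrow> x \<le> y" "snd x \<le> snd y \<longleftrightarrow> x \<le> y"
proof -
  have xy: "x \<in> \<pi>" "y \<in> \<pi>" using x y by (auto simp: of_rank_def)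
  have "\<not> pattern21 x y" "\<not> pattern21 y x"
    using pattern21_ranks[OF xy] pattern21_ranks[OF xy(2,1)] x y rank_cases(2)
    by (auto simp: of_rank_def)
  with coordinates_inj[OF xy] show "fst x \<le> fst y \<longleftrightarrow> x \<le> y" "snd x \<le> snd y \<longleftrightarrow> x \<le> y"
    unfolding pattern21_def less_eq_prod_def by linarith+
qed

lemma of_rank_chain: "x \<in> of_rank \<pi> r \<Longrightarrow> y \<in> of_rank \<pi> r \<Longrightarrow> x \<le> y \<or> y \<le> x"
  using of_rank_coordinates(1) by (metis nat_le_linear)

lemma index_le_iff:
  assumes "x \<in> of_rank \<pi> r" "y \<in> of_rank \<pi> r"
  shows "index r x \<le> index r y \<longleftrightarrow> fst x \<le> fst y" "index r x \<le> index r y \<longleftrightarrow> snd x \<le> snd y"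
  using chain_index_le_iff[OF finite_of_rank of_rank_chain assms(2,1)] of_rank_coordinates[OF assms]
  by simp_all

lemma index_bij: "bij_betw (index r) (of_rank \<pi> r) {1..card (of_rank \<pi> r)}"
  by (rule bij_betw_chain_index[OF finite_of_rank of_rank_chain])

lemma index_less_iff:
  assumes "x \<in> of_rank \<pi> r" "y \<in> of_rank \<pi> r"
  shows "index r x < index r y \<longleftrightarrow> fst x < fst y" "index r x < index r y \<longleftrightarrow> snd x < snd y"
  using index_le_iff[OF assms(2,1)] by (simp_all add: not_le[symmetric])

lemma L_eq: "L \<pi> = {(index 2 x, index 1 y) | x y. x \<in> of_rank \<pi> 2 \<and> y \<in> of_rank \<pi> 1 \<and> pattern21 x y}"
  by (auto simp: L_def is_kth_of_rank_def chain_index_def)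

lemma index_eq_iff:
  "x \<in> of_rank \<pi> r \<Longrightarrow> y \<in> of_rank \<pi> r \<Longrightarrow> index r x = index r y \<longleftrightarrow> x = y"
  using inj_on_eq_iff[OF bij_betw_imp_inj_on[OF index_bij]] .

lemma row_of_L:
  assumes "x \<in> of_rank \<pi> 2"
  shows "(index 2 x, j) \<in> L \<pi> \<longleftrightarrow> (\<exists>y\<in>of_rank \<pi> 1. j = index 1 y \<and> pattern21 x y)"
  unfolding L_eq mem_Collect_eq prod.inject using assms index_eq_iff[OF assms] by metis

lemma column_of_L:
  assumes "y \<in> of_rank \<pi> 1"
  shows "(i, index 1 y) \<in> L \<pi> \<longleftrightarrow> (\<exists>x\<in>of_rank \<pi> 2. i = index 2 x \<and> pattern21 x y)"
  unfolding L_eq mem_Collect_eq prod.inject using assms index_eq_iff[OF assms] by metis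

lemma index_in_L_iff:
  assumes "x \<in> of_rank \<pi> 2" "y \<in> of_rank \<pi> 1"
  shows "(index 2 x, index 1 y) \<in> L \<pi> \<longleftrightarrow> pattern21 x y"
  using row_of_L[OF assms(1)] index_eq_iff[OF assms(2)] assms(2) by metis

lemma row_exists:
  assumes x: "x \<in> of_rank \<pi> 2" obtains y where "y \<in> of_rank \<pi> 1" "pattern21 x y"
proof -
  from x obtain y where "x \<in> \<pi>" "y \<in> \<pi>" "pattern21 x y"
    by (auto simp: of_rank_def rank_def split: if_splits)
  with that pattern21_ranks(2) show ?thesis by blast
qed

lemma column_exists:
  assumes y: "y \<in> of_rank \<pi> 1" obtains x where "x \<in> of_rank \<pi> 2" "pattern21 x y"
proof -
  from y have "y \<in> \<pi>" and not_larger: "\<And>x. x \<in> \<pi> \<Longrightarrow> \<not> pattern21 y x"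
    by (auto simp: of_rank_def rank_def split: if_splits)
  with rigid obtain x where "x \<in> \<pi>" "pattern21 x y" unfolding two_rigid_def by blast
  with that pattern21_ranks(1) \<open>y \<in> \<pi>\<close> show ?thesis by blast
qed

lemma subdirect_product_L: "subdirect_product (card (of_rank \<pi> 2)) (card (of_rank \<pi> 1)) (L \<pi>)"
proof -
  let ?m = "card (of_rank \<pi> 2)" and ?n = "card (of_rank \<pi> 1)"
  have im: "index 2 ` of_rank \<pi> 2 = {1..?m}" "index 1 ` of_rank \<pi> 1 = {1..?n}"
    using index_bij by (auto simp: bij_betw_def)
  have sub: "L \<pi> \<subseteq> {1..?m} \<times> {1..?n}" unfolding L_eq im[symmetric] by blast
  \<comment> \<open>Only incomparable pairs matter; their meet and join are the two crossed pairs.\<close>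
  have crossing: "(i, j') \<in> L \<pi> \<and> (i', j) \<in> L \<pi>"
    if ij: "(i, j) \<in> L \<pi>" and ij': "(i', j') \<in> L \<pi>" and less: "i < i'" "j' < j" for i j i' j'
  proof -
    obtain x y where xy: "i = index 2 x" "j = index 1 y" "x \<in> of_rank \<pi> 2" "y \<in> of_rank \<pi> 1" "pattern21 x y"
      using ij unfolding L_eq by blast
    obtain x' y' where xy': "i' = index 2 x'" "j' = index 1 y'" "x' \<in> of_rank \<pi> 2" "y' \<in> of_rank \<pi> 1" "pattern21 x' y'"
      using ij' unfolding L_eq by blast
    have "fst x < fst x'" "snd x < snd x'" "fst y' < fst y" "snd y' < snd y"
      using index_less_iff xy xy' less by blast+
    then have "pattern21 x y'" "pattern21 x' y" using xy(5) xy'(5) by (auto simp: pattern21_def)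
    then show ?thesis using index_in_L_iff xy xy' by blast
  qed
  have "(min i i', min j j') \<in> L \<pi> \<and> (max i i', max j j') \<in> L \<pi>"
    if ij: "(i, j) \<in> L \<pi>" and ij': "(i', j') \<in> L \<pi>" for i j i' j'
  proof -
    consider "i \<le> i' \<and> j \<le> j'" | "i' \<le> i \<and> j' \<le> j" | "i < i' \<and> j' < j" | "i' < i \<and> j < j'"
      by linarith
    then show ?thesis
    proof cases
      case 3 with crossing[OF ij ij'] show ?thesis by simp
    next
      case 4 with crossing[OF ij' ij] show ?thesis by simp
    qed (use ij ij' in \<open>simp_all add: min_absorb1 min_absorb2 max_absorb1 max_absorb2\<close>)
  qed
  moreover have "\<exists>j. (i, j) \<in> L \<pi>" if i: "i \<in> {1..?m}" for i
  proof -
    obtain x where "x \<in> of_rank \<pi> 2" "i = index 2 x" using i unfolding im[symmetric] by blast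
    then show ?thesis using row_exists index_in_L_iff by metis
  qed
  moreover have "\<exists>i. (i, j) \<in> L \<pi>" if j: "j \<in> {1..?n}" for j
  proof -
    obtain y where "y \<in> of_rank \<pi> 1" "j = index 1 y" using j unfolding im[symmetric] by blast
    then show ?thesis using column_exists index_in_L_iff by metis
  qed
  ultimately show ?thesis using sub unfolding subdirect_product_iff by blast
qed

lemma rank_1_neq_rank_2:
  assumes "x \<in> of_rank \<pi> 2" "y \<in> of_rank \<pi> 1"
  shows "fst x \<noteq> fst y" "snd x \<noteq> snd y"
  using assms coordinates_inj[of x y] by (auto simp: of_rank_def)

lemma index_image_filter:
  assumes "A \<subseteq> {1..card (of_rank \<pi> r)}"
    and "\<And>x. x \<in> of_rank \<pi> r \<Longrightarrow> index r x \<in> A \<longleftrightarrow> P x"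
  shows "card A = card {x \<in> of_rank \<pi> r. P x}"
proof -
  have "A \<subseteq> index r ` of_rank \<pi> r" using assms(1) index_bij[of r] by (simp add: bij_betw_def)
  with assms(2) have "A = index r ` {x \<in> of_rank \<pi> r. P x}" by blast
  moreover have "inj_on (index r) {x \<in> of_rank \<pi> r. P x}"
    using bij_betw_imp_inj_on[OF index_bij] by (rule inj_on_subset) auto
  ultimately show ?thesis by (simp add: card_image)
qed

lemma index_in_range: "x \<in> of_rank \<pi> r \<Longrightarrow> index r x \<in> {1..card (of_rank \<pi> r)}"
  using index_bij[of r] by (auto simp: bij_betw_def)

text \<open>
  The following four lemmas express by \<open>L \<pi>\<close> the relative position of a rank 2 element \<open>x\<close>
  and a rank 1 element \<open>y\<close>.  If the pair is not an inversion, an inversion of \<open>x\<close> with some other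
  rank 1 element, or of \<open>y\<close> with some other rank 2 element, supplies the comparison.
\<close>

lemma card_passed_row:
  assumes x: "x \<in> of_rank \<pi> 2"
  shows "card (passed (L \<pi>) (card (of_rank \<pi> 1)) (index 2 x)) = card {y \<in> of_rank \<pi> 1. fst y < fst x}"
proof (rule index_image_filter)
  fix y assume y: "y \<in> of_rank \<pi> 1"
  obtain w where w: "w \<in> of_rank \<pi> 1" "pattern21 x w" using row_exists[OF x] .
  have "(\<forall>y'\<in>of_rank \<pi> 1. pattern21 x y' \<longrightarrow> index 1 y < index 1 y') \<longleftrightarrow> fst y < fst x"
  proof
    assume less: "\<forall>y'\<in>of_rank \<pi> 1. pattern21 x y' \<longrightarrow> index 1 y < index 1 y'"
    then have "\<not> pattern21 x y" using y by blast
    moreover have "snd y < snd x"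
      using less w index_less_iff(2)[OF y w(1)] by (auto simp: pattern21_def)
    ultimately show "fst y < fst x" using rank_1_neq_rank_2[OF x y] by (auto simp: pattern21_def)
  next
    assume "fst y < fst x"
    then show "\<forall>y'\<in>of_rank \<pi> 1. pattern21 x y' \<longrightarrow> index 1 y < index 1 y'"
      using index_less_iff(1)[OF y] by (auto simp: pattern21_def)
  qed
  then show "index 1 y \<in> passed (L \<pi>) (card (of_rank \<pi> 1)) (index 2 x) \<longleftrightarrow> fst y < fst x"
    using index_in_range[OF y] row_of_L[OF x] by (auto simp: passed_def)
qed (auto simp: passed_def)

lemma card_reached_row:
  assumes x: "x \<in> of_rank \<pi> 2"
  shows "card (reached (L \<pi>) (card (of_rank \<pi> 1)) (index 2 x)) = card {y \<in> of_rank \<pi> 1. snd y < snd x}"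
proof (rule index_image_filter)
  fix y assume y: "y \<in> of_rank \<pi> 1"
  obtain w where w: "w \<in> of_rank \<pi> 1" "pattern21 x w" using row_exists[OF x] .
  have "(\<exists>y'\<in>of_rank \<pi> 1. pattern21 x y' \<and> index 1 y \<le> index 1 y') \<longleftrightarrow> snd y < snd x"
  proof
    assume "\<exists>y'\<in>of_rank \<pi> 1. pattern21 x y' \<and> index 1 y \<le> index 1 y'"
    then show "snd y < snd x" using index_le_iff(2)[OF y] by (auto simp: pattern21_def)
  next
    assume "snd y < snd x"
    then have "pattern21 x y \<or> index 1 y \<le> index 1 w"
      using w index_le_iff(1)[OF y w(1)] rank_1_neq_rank_2[OF x y] by (auto simp: pattern21_def)
    then show "\<exists>y'\<in>of_rank \<pi> 1. pattern21 x y' \<and> index 1 y \<le> index 1 y'" using w y by blast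
  qed
  then show "index 1 y \<in> reached (L \<pi>) (card (of_rank \<pi> 1)) (index 2 x) \<longleftrightarrow> snd y < snd x"
    using index_in_range[OF y] row_of_L[OF x] by (auto simp: reached_def)
qed (auto simp: reached_def)

lemma card_reached_column:
  assumes y: "y \<in> of_rank \<pi> 1"
  shows "card (reached ((L \<pi>)\<inverse>) (card (of_rank \<pi> 2)) (index 1 y)) = card {x \<in> of_rank \<pi> 2. fst x < fst y}"
proof (rule index_image_filter)
  fix x assume x: "x \<in> of_rank \<pi> 2"
  obtain v where v: "v \<in> of_rank \<pi> 2" "pattern21 v y" using column_exists[OF y] .
  have "(\<exists>x'\<in>of_rank \<pi> 2. pattern21 x' y \<and> index 2 x \<le> index 2 x') \<longleftrightarrow> fst x < fst y"
  proof
    assume "\<exists>x'\<in>of_rank \<pi> 2. pattern21 x' y \<and> index 2 x \<le> index 2 x'"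
    then show "fst x < fst y" using index_le_iff(1)[OF x] by (auto simp: pattern21_def)
  next
    assume "fst x < fst y"
    then have "pattern21 x y \<or> index 2 x \<le> index 2 v"
      using v index_le_iff(2)[OF x v(1)] rank_1_neq_rank_2[OF x y] by (auto simp: pattern21_def)
    then show "\<exists>x'\<in>of_rank \<pi> 2. pattern21 x' y \<and> index 2 x \<le> index 2 x'" using v x by blast
  qed
  then show "index 2 x \<in> reached ((L \<pi>)\<inverse>) (card (of_rank \<pi> 2)) (index 1 y) \<longleftrightarrow> fst x < fst y"
    using index_in_range[OF x] column_of_L[OF y] by (auto simp: reached_def)
qed (auto simp: reached_def)

lemma card_passed_column:
  assumes y: "y \<in> of_rank \<pi> 1"
  shows "card (passed ((L \<pi>)\<inverse>) (card (of_rank \<pi> 2)) (index 1 y)) = card {x \<in> of_rank \<pi> 2. snd x < snd y}"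
proof (rule index_image_filter)
  fix x assume x: "x \<in> of_rank \<pi> 2"
  obtain v where v: "v \<in> of_rank \<pi> 2" "pattern21 v y" using column_exists[OF y] .
  have "(\<forall>x'\<in>of_rank \<pi> 2. pattern21 x' y \<longrightarrow> index 2 x < index 2 x') \<longleftrightarrow> snd x < snd y"
  proof
    assume less: "\<forall>x'\<in>of_rank \<pi> 2. pattern21 x' y \<longrightarrow> index 2 x < index 2 x'"
    then have "\<not> pattern21 x y" using x by blast
    moreover have "fst x < fst y"
      using less v index_less_iff(1)[OF x v(1)] by (auto simp: pattern21_def)
    ultimately show "snd x < snd y" using rank_1_neq_rank_2[OF x y] by (auto simp: pattern21_def)
  next
    assume "snd x < snd y"
    then show "\<forall>x'\<in>of_rank \<pi> 2. pattern21 x' y \<longrightarrow> index 2 x < index 2 x'"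
      using index_less_iff(2)[OF x] by (auto simp: pattern21_def)
  qed
  then show "index 2 x \<in> passed ((L \<pi>)\<inverse>) (card (of_rank \<pi> 2)) (index 1 y) \<longleftrightarrow> snd x < snd y"
    using index_in_range[OF x] column_of_L[OF y] by (auto simp: passed_def)
qed (auto simp: passed_def)

text \<open>
  A coordinate of \<open>x\<close> is the number of points that do not exceed \<open>x\<close> in it.  Among the points of the
  rank of \<open>x\<close> there are as many of them as the index of \<open>x\<close> says; the rest have the other rank.
\<close>

lemma coordinate_eq_index_plus:
  fixes f :: "nat \<times> nat \<Rightarrow> nat"
  assumes bij: "bij_betw f \<pi> {1..N}"
    and x: "x \<in> of_rank \<pi> r"
    and parts: "\<pi> = of_rank \<pi> r \<union> of_rank \<pi> s" "of_rank \<pi> r \<inter> of_rank \<pi> s = {}"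
    and le: "\<And>z. z \<in> of_rank \<pi> r \<Longrightarrow> f z \<le> f x \<longleftrightarrow> z \<le> x"
  shows "f x = index r x + card {y \<in> of_rank \<pi> s. f y < f x}"
proof -
  have x\<pi>: "x \<in> \<pi>" using x by (simp add: of_rank_def)
  have "f y \<noteq> f x" if y: "y \<in> of_rank \<pi> s" for y
  proof -
    have "y \<in> \<pi>" "y \<noteq> x" using x y parts(2) by (auto simp: of_rank_def)
    with inj_on_eq_iff[OF bij_betw_imp_inj_on[OF bij] _ x\<pi>] show ?thesis by blast
  qed
  then have "{y \<in> of_rank \<pi> s. f y \<le> f x} = {y \<in> of_rank \<pi> s. f y < f x}"
    using le_neq_implies_less less_imp_le by blast
  moreover have "{z \<in> of_rank \<pi> r. f z \<le> f x} = {z \<in> of_rank \<pi> r. z \<le> x}" using le by blast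
  moreover have "{z \<in> \<pi>. f z \<le> f x} = {z \<in> of_rank \<pi> r. f z \<le> f x} \<union> {z \<in> of_rank \<pi> s. f z \<le> f x}"
    using parts(1) by blast
  ultimately have eq:
    "{z \<in> \<pi>. f z \<le> f x} = {z \<in> of_rank \<pi> r. z \<le> x} \<union> {y \<in> of_rank \<pi> s. f y < f x}"
    by simp
  have "card {z \<in> \<pi>. f z \<le> f x} = index r x + card {y \<in> of_rank \<pi> s. f y < f x}"
    unfolding eq chain_index_def using finite_of_rank parts(2) by (intro card_Un_disjoint) auto
  with card_le_eq_self[OF bij x\<pi>] show ?thesis by simp
qed

lemma rank_2_eq_upper_point:
  assumes x: "x \<in> of_rank \<pi> 2"
  shows "x = upper_point (L \<pi>) (card (of_rank \<pi> 1)) (index 2 x)"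
proof -
  obtain N where N: "bij_betw fst \<pi> {1..N}" "bij_betw snd \<pi> {1..N}" by (rule coordinates_bij)
  show ?thesis
    using coordinate_eq_index_plus[OF N(1) x rank_cases of_rank_coordinates(1)[OF _ x]]
      coordinate_eq_index_plus[OF N(2) x rank_cases of_rank_coordinates(2)[OF _ x]]
    unfolding upper_point_def card_passed_row[OF x] card_reached_row[OF x] prod_eq_iff fst_conv snd_conv
    by blast
qed

lemma rank_1_eq_lower_point:
  assumes y: "y \<in> of_rank \<pi> 1"
  shows "y = lower_point (L \<pi>) (card (of_rank \<pi> 2)) (index 1 y)"
proof -
  obtain N where N: "bij_betw fst \<pi> {1..N}" "bij_betw snd \<pi> {1..N}" by (rule coordinates_bij)
  have parts: "\<pi> = of_rank \<pi> 1 \<union> of_rank \<pi> 2" "of_rank \<pi> 1 \<inter> of_rank \<pi> 2 = {}"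
    using rank_cases by blast+
  show ?thesis
    using coordinate_eq_index_plus[OF N(1) y parts of_rank_coordinates(1)[OF _ y]]
      coordinate_eq_index_plus[OF N(2) y parts of_rank_coordinates(2)[OF _ y]]
    unfolding lower_point_def upper_point_def card_reached_column[OF y] card_passed_column[OF y]
      prod_eq_iff fst_swap snd_swap fst_conv snd_conv
    by blast
qed

lemma perm_of_L: "perm_of (card (of_rank \<pi> 2)) (card (of_rank \<pi> 1)) (L \<pi>) = \<pi>"
proof -
  have "{1..card (of_rank \<pi> r)} = index r ` of_rank \<pi> r" for r
    using index_bij by (auto simp: bij_betw_def)
  then have "perm_of (card (of_rank \<pi> 2)) (card (of_rank \<pi> 1)) (L \<pi>) = of_rank \<pi> 2 \<union> of_rank \<pi> 1"
    unfolding perm_of_def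
    using rank_2_eq_upper_point rank_1_eq_lower_point by (simp add: image_image)
  then show ?thesis using rank_cases by simp
qed

end

section \<open>The correspondence\<close>

theorem theorem11:
  fixes m n :: nat
  assumes "m > 0" and "n > 0"
  shows "bij_betw L
    {\<pi> \<in> Av321. two_rigid \<pi> \<and> card (of_rank \<pi> 2) = m \<and> card (of_rank \<pi> 1) = n}
    {S. subdirect_product m n S}"
proof (rule bij_betw_byWitness[where f' = "perm_of m n"])
  show "\<forall>\<pi>\<in>{\<pi> \<in> Av321. two_rigid \<pi> \<and> card (of_rank \<pi> 2) = m \<and> card (of_rank \<pi> 1) = n}.
      perm_of m n (L \<pi>) = \<pi>"
    using perm_of_L by blast
  show "\<forall>S\<in>{S. subdirect_product m n S}. L (perm_of m n S) = S"
    using L_perm_of by blast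
  show "L ` {\<pi> \<in> Av321. two_rigid \<pi> \<and> card (of_rank \<pi> 2) = m \<and> card (of_rank \<pi> 1) = n}
      \<subseteq> {S. subdirect_product m n S}"
    using subdirect_product_L by blast
  show "perm_of m n ` {S. subdirect_product m n S}
      \<subseteq> {\<pi> \<in> Av321. two_rigid \<pi> \<and> card (of_rank \<pi> 2) = m \<and> card (of_rank \<pi> 1) = n}"
    using perm_of_in_Av321 two_rigid_perm_of card_of_rank_perm_of by blast
qed

end
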